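(* Let $F$ be a field. Every locally A-graded $F$-algebra is a PI algebra.
   Context: Algebras are associative $F$-algebras. An $F$-algebra $A$ is PI if there is a nonzero non-commutative polynomial $f\in F\langle x_1,\dots,x_N\rangle$ (for some $N$) such that $f(a_1,\dots,a_N)=0$ for all $a_1,\dots,a_N\in A$. Given a positive integer $n$, a locally A-graded algebra of size $n$ is a $\mathbb{Z}$-graded $F$-algebra $A=\bigoplus_{d\in\mathbb{Z}}A^d$ such that each homogeneous subspace is a direct sum of vector subspaces $A^d=\bigoplus_{1\le i,j\le n}A^d_{i,j}$ with: (1) $\dim A^d_{i,j}\le 1$ for all $d,i,j$; (2) there is a homogeneous linear basis $\mathcal{B}=\{e_{ij}^{(d)}\}$ of $A$ (one element $e_{ij}^{(d)}\in A_{i,j}^d$ for each triple $(d,i,j)$ with $A^d_{i,j}\ne 0$) such that $$e_{ij}^{(d_1)}e_{k\ell}^{(d_2)}=\begin{cases}\delta_{j,k}\,e_{i\ell}^{(d_1+d_2)}&\text{if }A_{i,\ell}^{d_1+d_2}\neq 0,\\ 0&\text{otherwise,}\end{cases}$$ where $\delta_{j,k}$ is the Kronecker delta. An algebra is locally A-graded if it is locally A-graded of size $n$ for some positive integer $n$. *)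

theory Defs
  imports Complex_Main "HOL-Library.Poly_Mapping"
begin

text \<open>Associative algebras over a field, not assumed to be commutative or to have a unit: the
  underlying ring is a type of class \<open>ring\<close>, which does not include a unit.\<close>

locale assoc_algebra = vector_space scale
  for scale :: "'f::field \<Rightarrow> 'a::ring \<Rightarrow> 'a" (infixr \<open>*s\<close> 75) +
  assumes scale_mult_left: "(c *s x) * y = c *s (x * y)"
    and scale_mult_right: "x * (c *s y) = c *s (x * y)"

text \<open>Words are lists of indices of variables. The product of the empty word does not exist in an
  algebra without unit; the value \<open>0\<close> given to it here is never used, because the polynomials in
  the definition of a PI algebra have no constant term.\<close>

fun word_value :: "(nat \<Rightarrow> 'a::ring) \<Rightarrow> nat list \<Rightarrow> 'a" where
  "word_value a [] = 0"
| "word_value a [i] = a i"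
| "word_value a (i # j # w) = a i * word_value a (j # w)"

text \<open>A non-commutative polynomial is a finitely supported function from words to the field.\<close>

definition nc_polys :: "nat \<Rightarrow> (nat list \<Rightarrow>\<^sub>0 'f::field) set" where
  "nc_polys N = {f. \<forall>w\<in>Poly_Mapping.keys f. set w \<subseteq> {1..N}}"

context assoc_algebra
begin

definition nc_eval :: "(nat list \<Rightarrow>\<^sub>0 'f) \<Rightarrow> (nat \<Rightarrow> 'a) \<Rightarrow> 'a" where
  "nc_eval f a = (\<Sum>w\<in>Poly_Mapping.keys f. Poly_Mapping.lookup f w *s word_value a w)"

text \<open>Excluding a constant term is forced: a polynomial with constant term \<open>c\<close> has the value
  \<open>c * 1\<close> at zero arguments (in the unitization of the algebra, if it has no unit).\<close>

definition PI_algebra :: bool where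
  "PI_algebra \<longleftrightarrow> (\<exists>N. \<exists>f \<in> nc_polys N. f \<noteq> 0 \<and> Poly_Mapping.lookup f [] = 0 \<and>
     (\<forall>a. nc_eval f a = 0))"

definition direct_sum_of :: "'i set \<Rightarrow> ('i \<Rightarrow> 'a set) \<Rightarrow> 'a set \<Rightarrow> bool" where
  "direct_sum_of I V W \<longleftrightarrow> subspace W \<and> (\<forall>i\<in>I. subspace (V i) \<and> V i \<subseteq> W) \<and>
     (\<forall>w\<in>W. \<exists>!v. (\<forall>i\<in>I. v i \<in> V i) \<and> (\<forall>i. i \<notin> I \<longrightarrow> v i = 0) \<and>
        finite {i. v i \<noteq> 0} \<and> w = (\<Sum>i | v i \<noteq> 0. v i))"

definition Z_graded :: "(int \<Rightarrow> 'a set) \<Rightarrow> bool" where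
  "Z_graded A \<longleftrightarrow> direct_sum_of UNIV A UNIV \<and>
     (\<forall>c d. \<forall>x\<in>A c. \<forall>y\<in>A d. x * y \<in> A (c + d))"

text \<open>The library's \<open>dim\<close> is \<open>0\<close> on infinite-dimensional subspaces, so finite dimension has to be
  demanded separately.\<close>

definition dim_le_one :: "'a set \<Rightarrow> bool" where
  "dim_le_one V \<longleftrightarrow> (\<exists>B. finite B \<and> V \<subseteq> span B) \<and> dim V \<le> 1"

definition nonzero_triples :: "nat \<Rightarrow> (int \<Rightarrow> nat \<Rightarrow> nat \<Rightarrow> 'a set) \<Rightarrow> (int \<times> nat \<times> nat) set" where
  "nonzero_triples n C = {(d, i, j). i \<in> {1..n} \<and> j \<in> {1..n} \<and> C d i j \<noteq> {0}}"

text \<open>Here \<open>C d i j\<close> is the component $A^d_{i,j}$ and \<open>e d i j\<close> the basis element $e_{ij}^{(d)}$;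
  values of \<open>e\<close> outside \<open>nonzero_triples n C\<close> are irrelevant.\<close>

definition locally_A_basis ::
  "nat \<Rightarrow> (int \<Rightarrow> nat \<Rightarrow> nat \<Rightarrow> 'a set) \<Rightarrow> (int \<Rightarrow> nat \<Rightarrow> nat \<Rightarrow> 'a) \<Rightarrow> bool" where
  "locally_A_basis n C e \<longleftrightarrow>
     (\<forall>(d, i, j) \<in> nonzero_triples n C. e d i j \<in> C d i j) \<and>
     inj_on (\<lambda>(d, i, j). e d i j) (nonzero_triples n C) \<and>
     independent ((\<lambda>(d, i, j). e d i j) ` nonzero_triples n C) \<and>
     span ((\<lambda>(d, i, j). e d i j) ` nonzero_triples n C) = UNIV \<and>
     (\<forall>(d\<^sub>1, i, j) \<in> nonzero_triples n C. \<forall>(d\<^sub>2, k, l) \<in> nonzero_triples n C.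
        e d\<^sub>1 i j * e d\<^sub>2 k l =
          (if C (d\<^sub>1 + d\<^sub>2) i l \<noteq> {0} then (if j = k then 1 else 0) *s e (d\<^sub>1 + d\<^sub>2) i l else 0))"

definition locally_A_graded_of_size :: "nat \<Rightarrow> bool" where
  "locally_A_graded_of_size n \<longleftrightarrow> (\<exists>A C. Z_graded A \<and>
     (\<forall>d. direct_sum_of ({1..n} \<times> {1..n}) (\<lambda>(i, j). C d i j) (A d)) \<and>
     (\<forall>d. \<forall>i\<in>{1..n}. \<forall>j\<in>{1..n}. dim_le_one (C d i j)) \<and>
     (\<exists>e. locally_A_basis n C e))"

definition locally_A_graded :: bool where
  "locally_A_graded \<longleftrightarrow> (\<exists>n>0. locally_A_graded_of_size n)"

end

end

theory Submission
  imports Defs "HOL-Library.List_Lexorder" "HOL-Library.Product_Lexorder" "HOL-Library.FuncSet"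
    "HOL-Library.Multiset" "HOL-Real_Asymp.Real_Asymp"
begin

text \<open>Let $H_{ij}$ be the span of the basis elements $e_{ij}^{(d)}$. Then $H_{ij} H_{kl}$ is zero for
  $j \neq k$ and lies in $H_{il}$ otherwise, and each $H_{ii}$ is commutative. Only these facts matter.

  We look for an identity $\sum_w c_w w$ over the $2^m$ words of length $m$ in two variables. Splitting
  the variables into their components in the $H_{ij}$ expands a word into a sum of products along walks
  in a graph with vertices $1, \dots, n$ and $2n^2$ edges. Adjacent loops at the same vertex commute, so
  among the walks with a given product the lexicographically least one leaves each vertex through edges
  in weakly increasing order, the last exit excepted. Such a walk is determined by its first edge,
  the number of times it uses each edge and the last exit from each vertex, so the number of such walks
  is polynomial in $m$. Collecting the coefficients of these products gives fewer than $2^m$ linear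
  equations for the $c_w$ once $m$ is large, hence a nonzero solution.\<close>

section \<open>Underdetermined linear systems\<close>

text \<open>Gaussian elimination: a pivot in row \<open>r\<close> removes that row together with the
  unknown \<open>w0\<close>, so there remain more unknowns than equations. A zero row imposes
  nothing.\<close>

lemma underdetermined_system:
  fixes M :: "'r \<Rightarrow> 'w \<Rightarrow> 'f::field"
  assumes "finite R" "finite W" "card R < card W"
  shows "\<exists>c. (\<exists>w\<in>W. c w \<noteq> 0) \<and> (\<forall>r\<in>R. (\<Sum>w\<in>W. M r w * c w) = 0)"
  using assms
proof (induction R arbitrary: W M rule: finite_induct)
  case empty
  then obtain w where "w \<in> W" by fastforce
  then show ?case by (intro exI[of _ "\<lambda>_. 1"]) auto
next
  case (insert r R)
  show ?case
  proof (cases "\<forall>w\<in>W. M r w = 0")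
    case True
    with insert.IH[of W M] insert.prems insert.hyps show ?thesis by auto
  next
    case False
    then obtain w0 where w0: "w0 \<in> W" "M r w0 \<noteq> 0" by blast
    define W' where "W' = W - {w0}"
    define M' where "M' q w = M q w - M q w0 / M r w0 * M r w" for q w
    have W: "W = insert w0 W'" "w0 \<notin> W'" "finite W'"
      using w0 insert.prems by (auto simp: W'_def)
    have "card R < card W'" using insert.prems insert.hyps W by auto
    from insert.IH[OF W(3) this, of M'] obtain c where
      c: "\<exists>w\<in>W'. c w \<noteq> 0" "\<And>q. q \<in> R \<Longrightarrow> (\<Sum>w\<in>W'. M' q w * c w) = 0" by blast
    define S where "S q = (\<Sum>w\<in>W'. M q w * c w)" for q
    \<comment> \<open>The value at \<open>w0\<close> solves row \<open>r\<close> for the pivot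
      unknown.\<close>
    define c' where "c' = c(w0 := - S r / M r w0)"
    have sum: "(\<Sum>w\<in>W. M q w * c' w) = M q w0 * (- S r / M r w0) + S q" for q
    proof -
      have "(\<Sum>w\<in>W'. M q w * c' w) = S q"
        unfolding S_def c'_def using W by (intro sum.cong) auto
      then show ?thesis using W by (simp add: c'_def)
    qed
    have "S q = M q w0 / M r w0 * S r" if "q \<in> R" for q
      using c(2)[OF that]
      by (simp add: M'_def S_def algebra_simps sum_subtractf sum_distrib_left)
    then have "(\<Sum>w\<in>W. M q w * c' w) = 0" if "q \<in> insert r R" for q
      using that w0 by (auto simp: sum)
    moreover have "\<exists>w\<in>W. c' w \<noteq> 0"
      using c(1) W by (auto simp: c'_def)
    ultimately show ?thesis by blast
  qed
qed

section \<open>Walks in a directed multigraph\<close>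

fun walk :: "('e \<Rightarrow> 'v) \<Rightarrow> ('e \<Rightarrow> 'v) \<Rightarrow> 'v \<Rightarrow> 'e list \<Rightarrow> 'v \<Rightarrow> bool" where
  "walk src tgt i [] j \<longleftrightarrow> i = j"
| "walk src tgt i (x # w) j \<longleftrightarrow> src x = i \<and> walk src tgt (tgt x) w j"

lemma walk_append:
  "walk src tgt i (u @ v) k \<longleftrightarrow> (\<exists>j. walk src tgt i u j \<and> walk src tgt j v k)"
  by (induction u arbitrary: i) auto

text \<open>What minimality forces when adjacent loops may be exchanged. The lexicographic order
  directly yields the comparison of heads, and this is enough to order the exits.\<close>

definition loop_sorted :: "('e::linorder \<Rightarrow> 'v) \<Rightarrow> ('e \<Rightarrow> 'v) \<Rightarrow> 'e list \<Rightarrow> bool" where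
  "loop_sorted src tgt w \<longleftrightarrow> (\<forall>a u v b i. w = a @ u @ v @ b \<longrightarrow> u \<noteq> [] \<longrightarrow> v \<noteq> [] \<longrightarrow>
     walk src tgt i u i \<longrightarrow> walk src tgt i v i \<longrightarrow> hd u \<le> hd v)"

lemma loop_sorted_Cons: "loop_sorted src tgt (x # w) \<Longrightarrow> loop_sorted src tgt w"
  unfolding loop_sorted_def by (metis append_Cons)

text \<open>Between consecutive visits to \<open>i\<close> the walk runs through a loop, and
  adjacent loops have ordered first edges. The last exit need not start a loop, hence
  \<open>butlast\<close>.\<close>

lemma sorted_exits:
  assumes "walk src tgt k w l" "loop_sorted src tgt w"
  shows "sorted (butlast (filter (\<lambda>x. src x = i) w))"
  using assms
proof (induction w arbitrary: k)
  case (Cons x u)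
  have walk_u: "walk src tgt (tgt x) u l" using Cons.prems by simp
  have IH: "sorted (butlast (filter (\<lambda>x. src x = i) u))"
    using Cons.IH[OF walk_u] Cons.prems loop_sorted_Cons by blast
  show ?case
  proof (cases "src x = i")
    case False
    with IH show ?thesis by simp
  next
    case True
    show ?thesis
    proof (cases "filter (\<lambda>x. src x = i) u")
      case Nil
      then show ?thesis by simp
    next
      case (Cons y ys)
      then obtain p q where u: "u = p @ y # q" and y: "src y = i"
        and ys: "ys = filter (\<lambda>x. src x = i) q"
        by (auto simp: filter_eq_Cons_iff)
      show ?thesis
      proof (cases ys)
        case Nil
        then show ?thesis using Cons True by simp
      next
        case (Cons z zs)
        then obtain p' q' where q: "q = p' @ z # q'" and z: "src z = i"
          using ys by (auto simp: filter_eq_Cons_iff)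
        \<comment> \<open>The third exit \<open>z\<close> closes the loop begun by \<open>y\<close>,
          so that two adjacent loops are available for comparing \<open>x\<close> with
          \<open>y\<close>.\<close>
        have "walk src tgt i (x # p) i" "walk src tgt i (y # p') i"
          using walk_u True y z by (auto simp: u q walk_append)
        moreover have "x # u = [] @ (x # p) @ (y # p') @ (z # q')" by (simp add: u q)
        ultimately have "x \<le> y"
          using Cons.prems(2) unfolding loop_sorted_def by (metis list.distinct(1) list.sel(1))
        moreover have "filter (\<lambda>x. src x = i) u = y # z # zs"
          using \<open>filter _ u = y # ys\<close> Cons by simp
        ultimately show ?thesis using IH True by (auto intro: order_trans)
      qed
    qed
  qed
qed simp

text \<open>A walk is recovered by following, at each vertex, the next unused exit.\<close>

lemma walk_eq_if_exits_eq:
  assumes "walk src tgt i w j" "walk src tgt i w' j'"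
    and "\<And>v. filter (\<lambda>x. src x = v) w = filter (\<lambda>x. src x = v) w'"
  shows "w = w'"
  using assms
proof (induction w arbitrary: i w')
  case Nil
  show ?case
  proof (cases w')
    case (Cons y u)
    with Nil(3)[of "src y"] show ?thesis by simp
  qed simp
next
  case (Cons x u)
  show ?case
  proof (cases w')
    case Nil
    with Cons.prems(3)[of "src x"] show ?thesis by simp
  next
    case (Cons y u')
    have src: "src x = i" "src y = i" using Cons.prems Cons by auto
    with Cons.prems(3)[of i] Cons have xy: "x = y" by simp
    have "filter (\<lambda>x. src x = v) u = filter (\<lambda>x. src x = v) u'" for v
      using Cons.prems(3)[of v] Cons xy by (auto split: if_splits)
    then have "u = u'"
      using Cons.IH[of "tgt x" u'] Cons.prems Cons xy by auto
    with xy Cons show ?thesis by simp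
  qed
qed

text \<open>At each vertex the edge counts fix the multiset of exits, and sortedness then fixes
  their order once the last exit is known. The factors of the bound count the possible first edges,
  edge counts in \<open>{0..m}\<close> and last exits.\<close>

lemma card_loop_sorted_walks:
  fixes src tgt :: "'e::linorder \<Rightarrow> 'v"
  assumes L: "finite L" and I: "finite I" "src ` L \<subseteq> I" and "m > 0"
    and R: "\<And>w. w \<in> R \<Longrightarrow> set w \<subseteq> L \<and> length w = m \<and> loop_sorted src tgt w \<and>
      (\<exists>i j. walk src tgt i w j)"
  shows "card R \<le> card L * ((m + 1) ^ card L * card L ^ card I)"
proof -
  define E where "E v w = filter (\<lambda>x. src x = v) w" for v w
  \<comment> \<open>A vertex that is never left gets the default \<open>hd w\<close>, so that the
    third component still takes values in \<open>L\<close>.\<close>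
  define key where "key w = (hd w, (\<lambda>l\<in>L. count (mset w) l),
    (\<lambda>v\<in>I. if E v w = [] then hd w else last (E v w)))" for w
  have key_in: "key w \<in> L \<times> (PiE L (\<lambda>_. {0..m})) \<times> (PiE I (\<lambda>_. L))" if "w \<in> R" for w
  proof -
    have w: "set w \<subseteq> L" "length w = m" using R[OF that] by auto
    then have "hd w \<in> L" using \<open>m > 0\<close> by (metis hd_in_set length_greater_0_conv subsetD)
    moreover have "count (mset w) l \<le> m" for l
      using w(2) by (metis count_le_size size_mset)
    moreover have "last (E v w) \<in> L" if "E v w \<noteq> []" for v
      using last_in_set[OF that] w(1) by (auto simp: E_def)
    ultimately show ?thesis by (auto simp: key_def)
  qed
  have inj: "inj_on key R"
  proof (rule inj_onI)
    fix w w' assume w: "w \<in> R" and w': "w' \<in> R" and key: "key w = key w'"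
    obtain i j i' j' where walk: "walk src tgt i w j" "walk src tgt i' w' j'"
      using R[OF w] R[OF w'] by blast
    have ne: "w \<noteq> []" "w' \<noteq> []" using R[OF w] R[OF w'] \<open>m > 0\<close> by auto
    note key' = key[unfolded key_def prod.inject]
    have hd: "hd w = hd w'"
      by (rule key'[THEN conjunct1])
    have kc: "(\<lambda>l\<in>L. count (mset w) l) = (\<lambda>l\<in>L. count (mset w') l)"
      by (rule key'[THEN conjunct2, THEN conjunct1])
    have kl: "(\<lambda>v\<in>I. if E v w = [] then hd w else last (E v w)) =
        (\<lambda>v\<in>I. if E v w' = [] then hd w' else last (E v w'))"
      by (rule key'[THEN conjunct2, THEN conjunct2])
    have cnt: "count (mset w) l = count (mset w') l" for l
    proof (cases "l \<in> L")
      case True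
      then show ?thesis using fun_cong[OF kc, of l] by simp
    next
      case False
      then have "l \<notin> set w" "l \<notin> set w'" using R[OF w] R[OF w'] by auto
      then show ?thesis by (simp add: count_eq_zero_iff[THEN iffD2])
    qed
    then have mset: "mset w = mset w'" by (simp add: multiset_eq_iff)
    have E: "E v w = E v w'" for v
    proof (cases "v \<in> I")
      case False
      then have "E v w = []" "E v w' = []"
        using R[OF w] R[OF w'] I(2) by (auto simp: E_def filter_empty_conv)
      then show ?thesis by simp
    next
      case True
      have mE: "mset (E v w) = mset (E v w')" using mset by (simp add: E_def)
      show ?thesis
      proof (cases "E v w = []")
        case True
        then show ?thesis using mE by simp
      next
        case False
        then have False': "E v w' \<noteq> []" using mE by auto
        have "(if E v w = [] then hd w else last (E v w)) =
          (if E v w' = [] then hd w' else last (E v w'))"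
          using fun_cong[OF kl, of v] \<open>v \<in> I\<close> by simp
        then have last: "last (E v w) = last (E v w')" using False False' by simp
        \<comment> \<open>Removing the common last exit leaves equal multisets, each with only one
          sorted arrangement.\<close>
        have eq: "E v w = butlast (E v w) @ [last (E v w)]"
          "E v w' = butlast (E v w') @ [last (E v w)]"
          using False False' last by (metis append_butlast_last_id)+
        then have "mset (butlast (E v w)) = mset (butlast (E v w'))"
          using mE by (metis add_right_cancel mset_append)
        moreover have "sorted (butlast (E v w))" "sorted (butlast (E v w'))"
          unfolding E_def using R[OF w] R[OF w']
          by (auto intro: sorted_exits[OF walk(1)] sorted_exits[OF walk(2)])
        ultimately have "butlast (E v w) = butlast (E v w')"
          by (metis properties_for_sort)
        then show ?thesis using eq by metis
      qed
    qed
    \<comment> \<open>The equal first edges give both walks the same starting vertex, from which the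
      exits can be replayed.\<close>
    have "i' = i" using walk ne hd by (cases w; cases w') auto
    then show "w = w'"
      using walk_eq_if_exits_eq[of src tgt i w j w' j'] walk E unfolding E_def by blast
  qed
  have "card R \<le> card (L \<times> (PiE L (\<lambda>_. {0..m})) \<times> (PiE I (\<lambda>_. L)))"
  proof (rule card_inj_on_le[OF inj])
    show "key ` R \<subseteq> L \<times> (PiE L (\<lambda>_. {0..m})) \<times> (PiE I (\<lambda>_. L))"
      using key_in by blast
    show "finite (L \<times> (PiE L (\<lambda>_. {0..m})) \<times> (PiE I (\<lambda>_. L)))"
      using L I by (intro finite_cartesian_product finite_PiE) auto
  qed
  also have "\<dots> = card L * ((m + 1) ^ card L * card L ^ card I)"
    using L I by (simp add: card_cartesian_product card_PiE)
  finally show ?thesis .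
qed

lemma append_left_le_cancel: "(a @ x \<le> a @ y) \<longleftrightarrow> x \<le> (y :: 'e::linorder list)"
  by (induction a) auto

text \<open>The left-hand side has the shape of the bound on loop-sorted walks.\<close>

lemma exists_exponential_dominates: "\<exists>m>0. c * ((m + 1) ^ k * d) < (2::nat) ^ m"
proof -
  have "(\<lambda>m. real (c * d) * (real m + 1) ^ k / 2 ^ m) \<longlonglongrightarrow> 0"
    by real_asymp
  then have "eventually (\<lambda>m. real (c * d) * (real m + 1) ^ k / 2 ^ m < 1) sequentially"
    by (rule order_tendstoD) simp
  then have "eventually (\<lambda>m::nat. real (c * d) * (real m + 1) ^ k < 2 ^ m) sequentially"
    by (simp add: field_simps)
  then obtain m where m: "m > 0" "real (c * d) * (real m + 1) ^ k < 2 ^ m"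
    by (metis (mono_tags, lifting) eventually_conj eventually_gt_at_top eventually_happens
        sequentially_bot)
  then have "real (c * ((m + 1) ^ k * d)) < real (2 ^ m)" by (simp add: algebra_simps)
  then show ?thesis using m(1) of_nat_less_iff by blast
qed

section \<open>Words in Peirce components\<close>

text \<open>\<open>word_value\<close> over an arbitrary alphabet, so that letters can also record
  components. The empty product is again 0 and not a unit, which is why nonemptiness conditions
  recur below.\<close>

fun word_prod :: "('e \<Rightarrow> 'a::ring) \<Rightarrow> 'e list \<Rightarrow> 'a" where
  "word_prod s [] = 0"
| "word_prod s [x] = s x"
| "word_prod s (x # y # w) = s x * word_prod s (y # w)"

lemma word_value_eq_word_prod: "word_value a w = word_prod a w"
  by (induction a w rule: word_value.induct) auto

lemma word_prod_Cons: "w \<noteq> [] \<Longrightarrow> word_prod s (x # w) = s x * word_prod s w"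
  by (cases w) auto

lemma word_prod_append:
  "u \<noteq> [] \<Longrightarrow> v \<noteq> [] \<Longrightarrow> word_prod s (u @ v) = word_prod s u * word_prod s v"
  by (induction s u rule: word_prod.induct) (auto simp: mult.assoc word_prod_Cons)

lemma word_prod_append_cong:
  assumes "word_prod s u = word_prod s v" "u \<noteq> []" "v \<noteq> []"
  shows "word_prod s (a @ u @ b) = word_prod s (a @ v @ b)"
  using assms by (cases "a = []"; cases "b = []") (auto simp: word_prod_append)

text \<open>The terms obtained by multiplying out a word whose letters are sums over
  \<open>Q\<close>: each letter is paired with a chosen summand.\<close>

definition typed_words :: "'p set \<Rightarrow> 'c list \<Rightarrow> ('c \<times> 'p) list set" where
  "typed_words Q w = {v. map fst v = w \<and> set v \<subseteq> UNIV \<times> Q}"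

lemma typed_words_Nil: "typed_words Q [] = {[]}"
  by (auto simp: typed_words_def)

lemma typed_words_Cons:
  "typed_words Q (c # w) = (\<lambda>(p, v). (c, p) # v) ` (Q \<times> typed_words Q w)"
  by (auto simp: typed_words_def Cons_eq_map_conv image_iff map_eq_Cons_conv)

lemma word_prod_sum:
  assumes "finite Q" "w \<noteq> []"
  shows "word_prod (\<lambda>c. \<Sum>p\<in>Q. s (c, p)) w = (\<Sum>v\<in>typed_words Q w. word_prod s v)"
  using assms(2)
proof (induction w)
  case (Cons c w)
  have inj: "inj_on (\<lambda>(p, v). (c, p) # v) (Q \<times> typed_words Q w)" by (auto simp: inj_on_def)
  show ?case
  proof (cases "w = []")
    case True
    then have "typed_words Q (c # w) = (\<lambda>p. [(c, p)]) ` Q"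
      by (auto simp: typed_words_Cons typed_words_Nil)
    then show ?thesis using True by (simp add: sum.reindex inj_on_def)
  next
    case False
    have ne: "v \<noteq> []" if "v \<in> typed_words Q w" for v
      using that False by (auto simp: typed_words_def)
    have "word_prod (\<lambda>c. \<Sum>p\<in>Q. s (c, p)) (c # w) =
      (\<Sum>p\<in>Q. s (c, p)) * (\<Sum>v\<in>typed_words Q w. word_prod s v)"
      using Cons.IH False by (simp add: word_prod_Cons)
    also have "\<dots> = (\<Sum>(p, v)\<in>Q \<times> typed_words Q w. s (c, p) * word_prod s v)"
      by (simp add: sum_product sum.cartesian_product)
    also have "\<dots> = (\<Sum>(p, v)\<in>Q \<times> typed_words Q w. word_prod s ((c, p) # v))"
      using ne by (intro sum.cong) (auto simp: word_prod_Cons)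
    also have "\<dots> = (\<Sum>v\<in>typed_words Q (c # w). word_prod s v)"
      using inj by (simp add: typed_words_Cons sum.reindex o_def case_prod_unfold)
    finally show ?thesis .
  qed
qed simp

section \<open>Polynomial identities from Peirce decompositions\<close>

locale peirce_decomposition = assoc_algebra scale
  for scale :: "'f::field \<Rightarrow> 'a::ring \<Rightarrow> 'a" (infixr \<open>*s\<close> 75) +
  fixes I :: "'v::linorder set" and H :: "'v \<Rightarrow> 'v \<Rightarrow> 'a set"
  assumes finite_I: "finite I"
    and mult_in: "x \<in> H i j \<Longrightarrow> y \<in> H j k \<Longrightarrow> x * y \<in> H i k"
    and mult_eq_0: "x \<in> H i j \<Longrightarrow> y \<in> H k l \<Longrightarrow> j \<noteq> k \<Longrightarrow> x * y = 0"
    and mult_commute_diagonal: "x \<in> H i i \<Longrightarrow> y \<in> H i i \<Longrightarrow> x * y = y * x"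
    and decompose: "\<exists>s. (\<forall>p. s p \<in> H (fst p) (snd p)) \<and> x = (\<Sum>p\<in>I \<times> I. s p)"
begin

text \<open>A letter \<open>(c, i, j)\<close> stands for the \<open>H i j\<close> component of the variable with
  index \<open>c\<close>; as an edge it runs from \<open>i\<close> to \<open>j\<close>.\<close>

abbreviation (input) src :: "nat \<times> 'v \<times> 'v \<Rightarrow> 'v" where "src x \<equiv> fst (snd x)"
abbreviation (input) tgt :: "nat \<times> 'v \<times> 'v \<Rightarrow> 'v" where "tgt x \<equiv> snd (snd x)"

definition homogeneous :: "(nat \<times> 'v \<times> 'v \<Rightarrow> 'a) \<Rightarrow> bool" where
  "homogeneous s \<longleftrightarrow> (\<forall>x. s x \<in> H (src x) (tgt x))"

lemma homogeneousD: "homogeneous s \<Longrightarrow> s x \<in> H (src x) (tgt x)"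
  unfolding homogeneous_def by blast

lemma word_prod_in:
  "homogeneous s \<Longrightarrow> w \<noteq> [] \<Longrightarrow> walk src tgt i w j \<Longrightarrow> word_prod s w \<in> H i j"
proof (induction s w arbitrary: i rule: word_prod.induct)
  case (2 s x)
  then show ?case using homogeneousD[of s x] by auto
next
  case (3 s x y w)
  then have "word_prod s (y # w) \<in> H (tgt x) j" by simp
  moreover have "s x \<in> H i (tgt x)" using 3 homogeneousD[of s x] by auto
  ultimately show ?case using mult_in by simp
qed simp

text \<open>Two adjacent edges fail to meet: either inside the tail, or at its front, where the tail
  is a walk and its product lies in a single component.\<close>

lemma word_prod_eq_0:
  "homogeneous s \<Longrightarrow> \<nexists>i j. walk src tgt i w j \<Longrightarrow> word_prod s w = 0"
proof (induction s w rule: word_prod.induct)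
  case (3 s x y w)
  show ?case
  proof (cases "\<exists>i j. walk src tgt i (y # w) j")
    case True
    then obtain j where j: "walk src tgt (src y) (y # w) j" by auto
    with 3(3) have "tgt x \<noteq> src y" by (metis walk.simps(2))
    moreover have "s x \<in> H (src x) (tgt x)" using 3(2) by (rule homogeneousD)
    ultimately show ?thesis using mult_eq_0 word_prod_in[OF 3(2) _ j] by simp
  next
    case False
    with 3(1)[OF 3(2)] show ?thesis by (simp add: word_prod_Cons)
  qed
qed auto

text \<open>Both loops take values in \<open>H i i\<close>, whose elements commute.\<close>

lemma word_prod_swap_loops:
  assumes "homogeneous s" "u \<noteq> []" "v \<noteq> []" "walk src tgt i u i" "walk src tgt i v i"
  shows "word_prod s (a @ u @ v @ b) = word_prod s (a @ v @ u @ b)"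
proof -
  have "word_prod s u * word_prod s v = word_prod s v * word_prod s u"
    using assms by (intro mult_commute_diagonal word_prod_in)
  then have "word_prod s (u @ v) = word_prod s (v @ u)"
    using assms by (simp add: word_prod_append)
  from word_prod_append_cong[OF this, of a b] show ?thesis using assms by simp
qed

definition walks :: "nat \<Rightarrow> (nat \<times> 'v \<times> 'v) list set" where
  "walks m = {w. set w \<subseteq> {1..2} \<times> I \<times> I \<and> length w = m \<and> (\<exists>i j. walk src tgt i w j)}"

text \<open>Quantifying over all homogeneous assignments makes the classes independent of the
  arguments substituted, so one choice of coefficients can serve them all.\<close>

definition same_prod :: "(nat \<times> 'v \<times> 'v) list \<Rightarrow> (nat \<times> 'v \<times> 'v) list \<Rightarrow> bool" where
  "same_prod w w' \<longleftrightarrow> (\<forall>s. homogeneous s \<longrightarrow> word_prod s w = word_prod s w')"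

text \<open>A canonical representative of the class of \<open>w\<close>, minimal for the
  lexicographic order on lists of lexicographically ordered triples.\<close>

definition least_walk :: "nat \<Rightarrow> (nat \<times> 'v \<times> 'v) list \<Rightarrow> (nat \<times> 'v \<times> 'v) list" where
  "least_walk m w = Min {w' \<in> walks m. same_prod w w'}"

lemma finite_walks: "finite (walks m)"
  using finite_lists_length_eq[of "{1..2::nat} \<times> I \<times> I" m] finite_I
  by (auto simp: walks_def elim: rev_finite_subset)

lemma least_walk:
  assumes "w \<in> walks m"
  shows "least_walk m w \<in> walks m" "same_prod w (least_walk m w)"
    "w' \<in> walks m \<Longrightarrow> same_prod w w' \<Longrightarrow> least_walk m w \<le> w'"
proof -
  let ?S = "{w' \<in> walks m. same_prod w w'}"
  have S: "finite ?S" using finite_walks by simp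
  have "w \<in> ?S" using assms by (simp add: same_prod_def)
  then have "Min ?S \<in> ?S" using S by (intro Min_in) auto
  then show "least_walk m w \<in> walks m" "same_prod w (least_walk m w)"
    by (auto simp: least_walk_def)
  show "least_walk m w \<le> w'" if "w' \<in> walks m" "same_prod w w'"
    unfolding least_walk_def using S that by (intro Min_le) auto
qed

lemma loop_sorted_least_walk:
  assumes "w \<in> walks m"
  shows "loop_sorted src tgt (least_walk m w)"
  unfolding loop_sorted_def
proof (intro allI impI)
  fix a u v b i
  assume eq: "least_walk m w = a @ u @ v @ b" and ne: "u \<noteq> []" "v \<noteq> []"
    and loops: "walk src tgt i u i" "walk src tgt i v i"
  have "a @ v @ u @ b \<in> walks m"
  proof -
    from least_walk(1)[OF assms] obtain k l where kl: "walk src tgt k (a @ u @ v @ b) l"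
      and "set (a @ u @ v @ b) \<subseteq> {1..2} \<times> I \<times> I" "length (a @ u @ v @ b) = m"
      unfolding eq walks_def by blast
    note letters = this(2,3)
    \<comment> \<open>Start and first loop determine where a walk passes: \<open>u\<close> and
      \<open>v\<close> sit at \<open>i\<close> inside the whole walk, so exchanging them gives a
      walk again.\<close>
    have unique: "j = j'" if "walk src tgt k' x j" "walk src tgt k' x j'" for k' x j j'
      using that by (induction x arbitrary: k') auto
    have start: "k' = i" if "walk src tgt k' u l'" for k' l'
      using that ne loops by (cases u) auto
    obtain i1 i2 i3 where a: "walk src tgt k a i1" and u: "walk src tgt i1 u i2"
      and v: "walk src tgt i2 v i3" and b: "walk src tgt i3 b l"
      using kl unfolding walk_append by blast
    have "i1 = i" using start u by blast
    moreover from this have "i2 = i" using unique u loops by blast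
    moreover from this have "i3 = i" using unique v loops by blast
    ultimately have "walk src tgt k a i" "walk src tgt i b l" using a b by auto
    then have "walk src tgt k (a @ v @ u @ b) l" using loops by (auto simp: walk_append)
    then show ?thesis using letters unfolding walks_def by auto
  qed
  moreover have "same_prod w (a @ v @ u @ b)"
    using least_walk(2)[OF assms] word_prod_swap_loops[OF _ ne loops]
    unfolding eq same_prod_def by simp
  ultimately have "a @ u @ v @ b \<le> a @ v @ u @ b"
    using least_walk(3)[OF assms] eq by metis
  \<comment> \<open>Past the common prefix \<open>a\<close>, the heads of \<open>u\<close> and
    \<open>v\<close> are the first letters compared.\<close>
  then have "u @ v @ b \<le> v @ u @ b" by (simp add: append_left_le_cancel)
  then show "hd u \<le> hd v" using ne by (cases u; cases v) auto
qed

text \<open>There will be one equation per least walk and one unknown for each of the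
  \<open>2 ^ m\<close> words in two variables.\<close>

lemma few_least_walks: "\<exists>m>0. card (least_walk m ` walks m) < 2 ^ m"
proof -
  let ?L = "{1..2::nat} \<times> I \<times> I"
  obtain m where m: "m > 0" "card ?L * ((m + 1) ^ card ?L * card ?L ^ card I) < 2 ^ m"
    using exists_exponential_dominates by blast
  have "card (least_walk m ` walks m) \<le> card ?L * ((m + 1) ^ card ?L * card ?L ^ card I)"
  proof (rule card_loop_sorted_walks)
    show "set w \<subseteq> ?L \<and> length w = m \<and> loop_sorted src tgt w \<and> (\<exists>i j. walk src tgt i w j)"
      if "w \<in> least_walk m ` walks m" for w
    proof -
      have "w \<in> walks m" "loop_sorted src tgt w"
        using that least_walk(1) loop_sorted_least_walk by blast+
      then show ?thesis by (simp add: walks_def)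
    qed
  qed (use finite_I m in auto)
  with m show ?thesis by (meson le_less_trans)
qed

lemma peirce_PI: "PI_algebra"
proof -
  obtain m where m: "m > 0" "card (least_walk m ` walks m) < 2 ^ m"
    using few_least_walks by blast
  define W where "W = {w. set w \<subseteq> {1..2::nat} \<and> length w = m}"
  define R where "R = least_walk m ` walks m"
  define P where "P r = {v \<in> walks m. least_walk m v = r}" for r
  have W: "finite W" "card W = 2 ^ m"
    using finite_lists_length_eq[of "{1..2::nat}" m] card_lists_length_eq[of "{1..2::nat}" m]
    by (auto simp: W_def)
  have R: "finite R" "card R < card W" using m W finite_walks by (auto simp: R_def)
  have finP: "finite (P r)" for r using finite_walks by (simp add: P_def)
  \<comment> \<open>The equation for \<open>r\<close> says that the total coefficient of its product
    vanishes: \<open>c w\<close> enters once for each walk in \<open>P r\<close> lying over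
    \<open>w\<close>.\<close>
  obtain c :: "nat list \<Rightarrow> 'f" where c0: "\<exists>w\<in>W. c w \<noteq> 0" and
    c: "\<And>r. r \<in> R \<Longrightarrow> (\<Sum>w\<in>W. of_nat (card {v \<in> P r. map fst v = w}) * c w) = 0"
    using underdetermined_system[OF R(1) W(1) R(2),
        of "\<lambda>r w. of_nat (card {v \<in> P r. map fst v = w})"] by blast
  have cP: "(\<Sum>v\<in>P r. c (map fst v)) = 0" if "r \<in> R" for r
  proof -
    have sub: "(\<lambda>v. map fst v) ` P r \<subseteq> W" by (fastforce simp: P_def walks_def W_def)
    have "(\<Sum>v\<in>P r. c (map fst v)) =
      (\<Sum>w\<in>W. \<Sum>v\<in>{v \<in> P r. map fst v = w}. c (map fst v))"
      using sum.group[OF finP W(1) sub, of "\<lambda>v. c (map fst v)"] by simp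
    also have "\<dots> = (\<Sum>w\<in>W. of_nat (card {v \<in> P r. map fst v = w}) * c w)"
      by (intro sum.cong) auto
    finally show ?thesis using c[OF that] by simp
  qed
  define f where "f = Abs_poly_mapping (\<lambda>w. if w \<in> W then c w else 0)"
  have f: "Poly_Mapping.lookup f w = (if w \<in> W then c w else 0)" for w
    unfolding f_def using W(1) by (subst Abs_poly_mapping_inverse) auto
  have keys: "Poly_Mapping.keys f \<subseteq> W" by (auto simp: in_keys_iff f split: if_splits)
  have eval: "nc_eval f a = 0" for a
  proof -
    \<comment> \<open>The components depend on the arguments \<open>a\<close>; the coefficients
      \<open>c\<close> were fixed before.\<close>
    obtain s where s: "\<And>k p. s k p \<in> H (fst p) (snd p)" "\<And>k. a k = (\<Sum>p\<in>I \<times> I. s k p)"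
      using decompose[of "a _"] by metis
    define t where "t x = s (fst x) (snd x)" for x
    have t: "homogeneous t" using s by (simp add: homogeneous_def t_def)
    have a: "a = (\<lambda>k. \<Sum>p\<in>I \<times> I. t (k, p))" using s by (auto simp: t_def)
    define V where "V = {v :: (nat \<times> 'v \<times> 'v) list. set v \<subseteq> {1..2} \<times> I \<times> I \<and> length v = m}"
    have finV: "finite V"
      unfolding V_def using finite_I by (intro finite_lists_length_eq) auto
    have VW: "map fst ` V \<subseteq> W" by (fastforce simp: V_def W_def)
    have typed: "typed_words (I \<times> I) w = {v \<in> V. map fst v = w}" if "w \<in> W" for w
      using that by (fastforce simp: typed_words_def V_def W_def)
    have "nc_eval f a = (\<Sum>w\<in>W. c w *s word_value a w)"
      unfolding nc_eval_def using keys W(1)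
      by (intro sum.mono_neutral_cong_left) (auto simp: f in_keys_iff)
    also have "\<dots> = (\<Sum>w\<in>W. \<Sum>v\<in>{v \<in> V. map fst v = w}. c (map fst v) *s word_prod t v)"
    proof (intro sum.cong refl)
      fix w assume w: "w \<in> W"
      then have "w \<noteq> []" using m by (auto simp: W_def)
      then have "word_value a w = (\<Sum>v\<in>typed_words (I \<times> I) w. word_prod t v)"
        using finite_I by (simp add: word_value_eq_word_prod a word_prod_sum)
      then show "c w *s word_value a w =
          (\<Sum>v\<in>{v \<in> V. map fst v = w}. c (map fst v) *s word_prod t v)"
        using typed[OF w] by (simp add: scale_sum_right)
    qed
    also have "\<dots> = (\<Sum>v\<in>V. c (map fst v) *s word_prod t v)"
      using finV W VW by (intro sum.group) auto
    \<comment> \<open>Letter sequences that are not walks have product 0.\<close>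
    also have "\<dots> = (\<Sum>v\<in>walks m. c (map fst v) *s word_prod t v)"
      using finV word_prod_eq_0[OF t]
      by (intro sum.mono_neutral_right) (auto simp: V_def walks_def)
    also have "\<dots> = (\<Sum>r\<in>R. \<Sum>v\<in>P r. c (map fst v) *s word_prod t v)"
      unfolding P_def using finite_walks R by (intro sum.group[symmetric]) (auto simp: R_def)
    \<comment> \<open>All walks in \<open>P r\<close> have the same product as \<open>r\<close>, so
      their coefficients add up to a sum that \<open>c\<close> makes vanish.\<close>
    also have "\<dots> = (\<Sum>r\<in>R. (\<Sum>v\<in>P r. c (map fst v)) *s word_prod t r)"
      unfolding scale_sum_left
      using least_walk(2) t by (intro sum.cong) (auto simp: P_def same_prod_def)
    also have "\<dots> = 0" using cP by simp
    finally show ?thesis .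
  qed
  have "f \<in> nc_polys 2" using keys by (auto simp: nc_polys_def W_def)
  moreover have "f \<noteq> 0" using c0 f by (metis lookup_zero)
  moreover have "Poly_Mapping.lookup f [] = 0" using m by (auto simp: f W_def)
  ultimately show ?thesis unfolding PI_algebra_def using eval by blast
qed

end

section \<open>From a locally A-graded basis to a Peirce decomposition\<close>

context assoc_algebra
begin

text \<open>Linearity in the second factor, then in the first, reduces the claim to spanning sets;
  the next two lemmas use the same reduction.\<close>

lemma mult_zero_on_span:
  assumes "\<And>b b'. b \<in> B \<Longrightarrow> b' \<in> B' \<Longrightarrow> b * b' = 0" "x \<in> span B" "y \<in> span B'"
  shows "x * y = 0"
proof -
  have "b * y = 0" if "b \<in> B" for b
    using assms(3) by (induction rule: span_induct_alt) (auto simp: distrib_left scale_mult_right assms(1) that)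
  with assms(2) show ?thesis
    by (induction rule: span_induct_alt) (auto simp: distrib_right scale_mult_left)
qed

lemma mult_in_span:
  assumes "\<And>b b'. b \<in> B \<Longrightarrow> b' \<in> B' \<Longrightarrow> b * b' \<in> span D" "x \<in> span B" "y \<in> span B'"
  shows "x * y \<in> span D"
proof -
  have "b * y \<in> span D" if "b \<in> B" for b
    using assms(3) by (induction rule: span_induct_alt)
      (auto simp: distrib_left scale_mult_right intro!: span_add span_scale span_zero assms(1) that)
  with assms(2) show ?thesis
    by (induction rule: span_induct_alt)
      (auto simp: distrib_right scale_mult_left intro!: span_add span_scale span_zero)
qed

lemma mult_commute_span:
  assumes "\<And>b b'. b \<in> B \<Longrightarrow> b' \<in> B \<Longrightarrow> b * b' = b' * b" "x \<in> span B" "y \<in> span B"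
  shows "x * y = y * x"
proof -
  have "b * y = y * b" if "b \<in> B" for b
    using assms(3) by (induction rule: span_induct_alt)
      (auto simp: distrib_left distrib_right scale_mult_right scale_mult_left assms(1)[OF that])
  with assms(2) show ?thesis
    by (induction rule: span_induct_alt)
      (auto simp: distrib_left distrib_right scale_mult_right scale_mult_left)
qed

lemma locally_A_graded_PI:
  assumes "locally_A_graded"
  shows "PI_algebra"
proof -
  obtain n C e where basis: "locally_A_basis n C e"
    using assms unfolding locally_A_graded_def locally_A_graded_of_size_def by blast
  define T where "T = nonzero_triples n C"
  \<comment> \<open>Collecting all degrees leaves only finitely many pairs of indices, although each
    span may be infinite-dimensional.\<close>
  define B where "B i j = {e d i j | d. (d, i, j) \<in> T}" for i j
  have T: "i \<in> {1..n}" "j \<in> {1..n}" "C d i j \<noteq> {0}" if "(d, i, j) \<in> T" for d i j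
    using that by (auto simp: T_def nonzero_triples_def)
  have mult: "e d i j * e d' k l =
      (if C (d + d') i l \<noteq> {0} then (if j = k then 1 else 0) *s e (d + d') i l else 0)"
    if "(d, i, j) \<in> T" "(d', k, l) \<in> T" for d i j d' k l
    using basis that unfolding locally_A_basis_def T_def by fast
  have "peirce_decomposition scale {1..n} (\<lambda>i j. span (B i j))"
  proof unfold_locales
    fix i j k x y assume "x \<in> span (B i j)" "y \<in> span (B j k)"
    then show "x * y \<in> span (B i k)"
    proof (rule mult_in_span[rotated])
      fix b b' assume "b \<in> B i j" "b' \<in> B j k"
      then obtain d d' where dd: "(d, i, j) \<in> T" "(d', j, k) \<in> T" "b = e d i j" "b' = e d' j k"
        by (auto simp: B_def)
      have "e (d + d') i k \<in> B i k" if "C (d + d') i k \<noteq> {0}"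
      proof -
        have "(d + d', i, k) \<in> T"
          unfolding T_def nonzero_triples_def using T[OF dd(1)] T[OF dd(2)] that by simp
        then show ?thesis by (auto simp: B_def)
      qed
      then show "b * b' \<in> span (B i k)"
        using mult[OF dd(1,2)] dd by (auto intro: span_base span_zero)
    qed
  next
    fix i j k l :: nat and x y
    assume x: "x \<in> span (B i j)" and y: "y \<in> span (B k l)" and "j \<noteq> k"
    then have "b * b' = 0" if "b \<in> B i j" "b' \<in> B k l" for b b'
      using that by (auto simp: B_def mult)
    from mult_zero_on_span[OF this x y] show "x * y = 0" .
  next
    fix i x y assume x: "x \<in> span (B i i)" and y: "y \<in> span (B i i)"
    \<comment> \<open>On the diagonal both products depend only on the sum of the two
      degrees.\<close>
    have "b * b' = b' * b" if "b \<in> B i i" "b' \<in> B i i" for b b'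
      using that by (auto simp: B_def mult add.commute)
    from mult_commute_span[OF this x y] show "x * y = y * x" .
  next
    fix x
    have "x \<in> span ((\<lambda>(d, i, j). e d i j) ` T)"
      using basis by (simp add: locally_A_basis_def T_def)
    then show "\<exists>s. (\<forall>p. s p \<in> span (B (fst p) (snd p))) \<and> x = (\<Sum>p\<in>{1..n} \<times> {1..n}. s p)"
    proof (induction rule: span_induct_alt)
      case base
      show ?case by (intro exI[of _ "\<lambda>_. 0"]) (auto simp: span_zero)
    next
      case (step c b y)
      then obtain d i j s where b: "b = e d i j" "(d, i, j) \<in> T"
        and s: "\<forall>p. s p \<in> span (B (fst p) (snd p))" "y = (\<Sum>p\<in>{1..n} \<times> {1..n}. s p)" by auto
      \<comment> \<open>The new term of the linear combination joins the summand of its own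
        component.\<close>
      define s' where "s' p = (if p = (i, j) then c *s b else 0) + s p" for p
      have "b \<in> span (B i j)" using b by (auto simp: B_def intro: span_base)
      then have "s' p \<in> span (B (fst p) (snd p))" for p
        using spec[OF s(1), of p] by (auto simp: s'_def intro!: span_add span_scale span_zero)
      moreover have "(\<Sum>p\<in>{1..n} \<times> {1..n}. s' p) = c *s b + y"
        using s(2) T[OF b(2)] by (simp add: s'_def sum.distrib)
      ultimately show ?case by metis
    qed
  qed simp
  then show ?thesis by (rule peirce_decomposition.peirce_PI)
qed

end

theorem theorem1p3:
  fixes scale :: "'f::field \<Rightarrow> 'a::ring \<Rightarrow> 'a"
  assumes "assoc_algebra scale"
    and "assoc_algebra.locally_A_graded scale"
  shows "assoc_algebra.PI_algebra scale"
  using assms by (rule assoc_algebra.locally_A_graded_PI)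

end
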